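(* Let $k>0$ and $m\in\mathbb{N}$. Suppose $A$ and $B$ are two nonempty closed and convex subsets of the model space $M_k^m$. Let $C\subseteq M_k^m$ be nonempty and convex with $\mathrm{diam}(C)<D_k/2$ such that $A,B\subseteq C$ and $R_AR_B(C)\subseteq C$. Assume that the reflections are well-defined, i.e. that $\mathrm{dist}(R_Bz,A)<D_k/2$ for every $z$ in the closure $\overline{C}$. Let $T=\frac{I+R_AR_B}{2}$, i.e. $Tz$ is the midpoint of the geodesic segment joining $z$ and $R_A(R_Bz)$. Let $x_0\in C$ and let $(x_n)$ be the sequence starting at $x_0$ generated by the averaged alternating reflection (AAR) method, that is, $x_n=T^nx_0$ for every $n\ge 1$. Then: (1) Any convergent subsequence $(x_{n_i})$ of $(x_n)$ converges to a fixed point $x$ of the mapping $T$, and $P_Bx\in A\cap B$. (2) The "shadow" sequence $(P_Bx_n)$ is bounded and each of its cluster points belongs to $A\cap B$.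
   Context: Model spaces: for $k>0$, $M_k^m$ is the unit sphere $\mathbb{S}^m\subseteq\mathbb{R}^{m+1}$ with the spherical distance (given by $\cos d(x,y)=(x\mid y)$, $d(x,y)\in[0,\pi]$) multiplied by $1/\sqrt{k}$; $D_k=\pi/\sqrt{k}$. A geodesic segment joining $x$ and $y$ is the image of an isometric embedding of $[0,d(x,y)]$ with endpoints $x$ and $y$; it is unique if $d(x,y)<D_k$. A subset is convex if it contains every geodesic segment joining any two of its points. $\mathrm{dist}(x,S)=\inf_{y\in S}d(x,y)$. For a nonempty closed convex set $S\subseteq M_k^m$ and a point $x$ with $\mathrm{dist}(x,S)<D_k/2$, the metric projection $P_Sx$ is the unique point of $S$ nearest to $x$, and the reflection $R_Sx$ is the unique point $z$ obtained by extending the geodesic segment $[x,P_Sx]$ beyond $P_Sx$ so that $P_Sx$ is the midpoint of $[x,z]$, i.e. $d(x,P_Sx)=d(z,P_Sx)=\tfrac12 d(x,z)$ (so $R_Sx=x$ if $x\in S$). $I$ is the identity mapping. *)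

theory Defs
  imports "HOL-Analysis.Analysis"
begin

text \<open>
  The model space of curvature \<open>k > 0\<close> has the unit sphere \<open>sphere 0 1\<close> as carrier, whatever the
  value of \<open>k\<close>; only the distance depends on \<open>k\<close>. The locale \<open>Metric_space\<close> wants a distance that
  is symmetric and nonnegative on the whole ambient type, whereas \<open>arccos\<close> is unspecified outside
  \<open>{-1..1}\<close>; the distance is therefore set to 0 off the sphere.
\<close>

abbreviation model_space :: "'a::real_inner set" where
  "model_space \<equiv> sphere 0 1"

definition model_dist :: "real \<Rightarrow> 'a::real_inner \<Rightarrow> 'a \<Rightarrow> real" where
  "model_dist k x y =
    (if x \<in> model_space \<and> y \<in> model_space then arccos (x \<bullet> y) / sqrt k else 0)"

definition model_diam :: "real \<Rightarrow> real" where
  "model_diam k = pi / sqrt k"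

lemma arccos_inner_triangle:
  fixes x y z :: "'a::real_inner"
  assumes x: "norm x = 1" and y: "norm y = 1" and z: "norm z = 1"
  shows "arccos (x \<bullet> z) \<le> arccos (x \<bullet> y) + arccos (y \<bullet> z)"
proof -
  have bd: "\<bar>u \<bullet> v\<bar> \<le> 1" if "norm u = 1" "norm v = 1" for u v :: 'a
    using Cauchy_Schwarz_ineq2[of u v] that by simp
  define a b c where "a = x \<bullet> y" and "b = y \<bullet> z" and "c = x \<bullet> z"
  have abs: "\<bar>a\<bar> \<le> 1" "\<bar>b\<bar> \<le> 1" "\<bar>c\<bar> \<le> 1"
    using bd x y z by (auto simp: a_def b_def c_def)
  have unit: "x \<bullet> x = 1" "y \<bullet> y = 1" "z \<bullet> z = 1"
    using x y z by (simp_all add: dot_square_norm)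
  have "norm (x - a *\<^sub>R y) = sqrt (1 - a\<^sup>2)"
    unfolding norm_eq_sqrt_inner
    by (simp add: unit inner_diff_left inner_diff_right a_def inner_commute power2_eq_square)
  moreover have "norm (z - b *\<^sub>R y) = sqrt (1 - b\<^sup>2)"
    unfolding norm_eq_sqrt_inner
    by (simp add: unit inner_diff_left inner_diff_right b_def inner_commute power2_eq_square)
  moreover have "(x - a *\<^sub>R y) \<bullet> (z - b *\<^sub>R y) = c - a * b"
    by (simp add: unit inner_diff_left inner_diff_right a_def b_def c_def inner_commute)
  ultimately have le: "a * b - sqrt (1 - a\<^sup>2) * sqrt (1 - b\<^sup>2) \<le> c"
    using Cauchy_Schwarz_ineq2[of "x - a *\<^sub>R y" "z - b *\<^sub>R y"] by simp
  show ?thesis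
  proof (cases "arccos a + arccos b \<le> pi")
    case True
    have "cos (arccos a + arccos b) = a * b - sqrt (1 - a\<^sup>2) * sqrt (1 - b\<^sup>2)"
      using abs by (simp add: cos_add cos_arccos_abs sin_arccos_abs)
    with le have "cos (arccos a + arccos b) \<le> c" by simp
    then have "arccos c \<le> arccos (cos (arccos a + arccos b))"
      using abs by (intro arccos_le_arccos) (auto simp: abs_le_iff)
    also have "\<dots> = arccos a + arccos b"
      using True abs by (intro arccos_cos) (auto simp: abs_le_iff arccos_lbound)
    finally show ?thesis by (simp add: a_def b_def c_def)
  next
    case False
    moreover have "arccos c \<le> pi" using abs by (intro arccos_ubound) auto
    ultimately show ?thesis by (simp add: a_def b_def c_def)
  qed
qed

lemma Metric_space_model:
  assumes "0 < k"
  shows "Metric_space (model_space :: 'a::real_inner set) (model_dist k)"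
proof
  fix x y z :: 'a
  have bd: "\<bar>u \<bullet> v\<bar> \<le> 1" if "norm u = 1" "norm v = 1" for u v :: 'a
    using Cauchy_Schwarz_ineq2[of u v] that by simp
  show "0 \<le> model_dist k x y"
    using bd[of x y] assms by (auto simp: model_dist_def abs_le_iff intro!: divide_nonneg_nonneg arccos_lbound)
  show "model_dist k x y = model_dist k y x"
    by (auto simp: model_dist_def inner_commute)
  show "model_dist k x y = 0 \<longleftrightarrow> x = y" if "x \<in> model_space" "y \<in> model_space"
  proof -
    have n: "norm x = 1" "norm y = 1" using that by auto
    have "model_dist k x y = 0 \<longleftrightarrow> arccos (x \<bullet> y) = 0"
      using that assms by (simp add: model_dist_def)
    also have "\<dots> \<longleftrightarrow> x \<bullet> y = 1"
      using bd[OF n] by (metis arccos_1 cos_arccos_abs cos_zero)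
    also have "\<dots> \<longleftrightarrow> x = y"
      using n norm_cauchy_schwarz_eq[of x y] by (auto simp: dot_square_norm)
    finally show ?thesis .
  qed
  show "model_dist k x z \<le> model_dist k x y + model_dist k y z"
    if "x \<in> model_space" "y \<in> model_space" "z \<in> model_space"
    using that assms arccos_inner_triangle[of x y z]
    by (simp add: model_dist_def add_divide_distrib[symmetric] divide_right_mono)
qed

definition model_topology :: "real \<Rightarrow> 'a::real_inner topology" where
  "model_topology k = Metric_space.mtopology model_space (model_dist k)"

definition geodesic_segment :: "real \<Rightarrow> 'a::real_inner \<Rightarrow> 'a \<Rightarrow> 'a set \<Rightarrow> bool" where
  "geodesic_segment k x y G \<longleftrightarrow>
    (\<exists>c \<in> {0..model_dist k x y} \<rightarrow> model_space.
       c 0 = x \<and> c (model_dist k x y) = y \<and>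
       (\<forall>s\<in>{0..model_dist k x y}. \<forall>t\<in>{0..model_dist k x y}. model_dist k (c s) (c t) = \<bar>s - t\<bar>) \<and>
       G = c ` {0..model_dist k x y})"

definition geodesically_convex :: "real \<Rightarrow> 'a::real_inner set \<Rightarrow> bool" where
  "geodesically_convex k S \<longleftrightarrow>
    S \<subseteq> model_space \<and> (\<forall>x\<in>S. \<forall>y\<in>S. \<forall>G. geodesic_segment k x y G \<longrightarrow> G \<subseteq> S)"

text \<open>The next two real-valued extrema are meaningful for nonempty \<open>S \<subseteq> model_space\<close> only.\<close>

definition dist_to_set :: "real \<Rightarrow> 'a::real_inner \<Rightarrow> 'a set \<Rightarrow> real" where
  "dist_to_set k x S = (INF y\<in>S. model_dist k x y)"

definition set_diam :: "real \<Rightarrow> 'a::real_inner set \<Rightarrow> real" where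
  "set_diam k S = (SUP (x, y)\<in>S \<times> S. model_dist k x y)"

definition is_midpoint :: "real \<Rightarrow> 'a::real_inner \<Rightarrow> 'a \<Rightarrow> 'a \<Rightarrow> bool" where
  "is_midpoint k x y w \<longleftrightarrow>
    (\<exists>G. geodesic_segment k x y G \<and> w \<in> G \<and>
         model_dist k x w = model_dist k x y / 2 \<and> model_dist k y w = model_dist k x y / 2)"

text \<open>
  The following operations are total functions, meaningful where the described point exists and is
  unique: for \<open>proj\<close> and \<open>refl_in\<close>, when \<open>S\<close> is nonempty, closed and convex and
  \<open>dist_to_set k x S < model_diam k / 2\<close>; for \<open>geodesic_midpoint\<close>, when
  \<open>model_dist k x y < model_diam k\<close>.
\<close>

definition proj :: "real \<Rightarrow> 'a::real_inner set \<Rightarrow> 'a \<Rightarrow> 'a" where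
  "proj k S x = (THE p. p \<in> S \<and> (\<forall>y\<in>S. model_dist k x p \<le> model_dist k x y))"

definition refl_in :: "real \<Rightarrow> 'a::real_inner set \<Rightarrow> 'a \<Rightarrow> 'a" where
  "refl_in k S x = (THE z. is_midpoint k x z (proj k S x))"

definition geodesic_midpoint :: "real \<Rightarrow> 'a::real_inner \<Rightarrow> 'a \<Rightarrow> 'a" where
  "geodesic_midpoint k x y = (THE w. is_midpoint k x y w)"

definition AAR :: "real \<Rightarrow> 'a::real_inner set \<Rightarrow> 'a set \<Rightarrow> 'a \<Rightarrow> 'a" where
  "AAR k A B z = geodesic_midpoint k z (refl_in k A (refl_in k B z))"

definition cluster_point :: "real \<Rightarrow> (nat \<Rightarrow> 'a::real_inner) \<Rightarrow> 'a \<Rightarrow> bool" where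
  "cluster_point k u y \<longleftrightarrow>
    y \<in> model_space \<and>
    (\<forall>U. openin (model_topology k) U \<and> y \<in> U \<longrightarrow> (\<exists>\<^sub>F n in sequentially. u n \<in> U))"

end

theory Submission
  imports Defs
begin

text \<open>
  For \<open>p = P\<^sub>S x\<close> the reflection is \<open>R\<^sub>S x = 2 (x \<bullet> p) p - x\<close>, and the variational inequality
  \<open>x \<bullet> q \<le> (x \<bullet> p) (p \<bullet> q)\<close> for \<open>q \<in> S\<close> makes it nonexpansive for the Euclidean distance. So
  \<open>N = R\<^sub>A R\<^sub>B\<close> is nonexpansive on the closure of \<open>C\<close>, where \<open>T z = (z + N z) / \<bar>z + N z\<bar>\<close>. By
  Brouwer's theorem \<open>T\<close> has a fixed point \<open>f\<close> there, and \<open>N f = f\<close>. Since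
  \<open>T z \<bullet> f = (z \<bullet> f + N z \<bullet> f) / \<bar>z + N z\<bar> \<ge> 2 (z \<bullet> f) / \<bar>z + N z\<bar>\<close>, the sequence \<open>x\<^sub>n \<bullet> f\<close>
  increases, so it takes the same limit along \<open>x\<^sub>n\<close> and \<open>T x\<^sub>n\<close>; at a subsequential limit \<open>l\<close> this
  forces \<open>\<bar>l + N l\<bar> = 2\<close>, that is \<open>N l = l\<close>. Then \<open>P\<^sub>B l\<close> and \<open>P\<^sub>A (R\<^sub>B l)\<close> are both the midpoint of \<open>l\<close>
  and \<open>R\<^sub>B l\<close>, so they coincide. The statement on the shadow sequence follows by compactness.
\<close>

section \<open>Distance and topology of the model space\<close>

lemma inner_unit_bounds:
  fixes x y :: "'a::real_inner"
  assumes "norm x = 1" "norm y = 1"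
  shows "-1 \<le> x \<bullet> y" "x \<bullet> y \<le> 1"
  using Cauchy_Schwarz_ineq2[of x y] assms by auto

lemma dist_unit_square:
  fixes x y :: "'a::real_inner"
  assumes "norm x = 1" "norm y = 1"
  shows "(dist x y)\<^sup>2 = 2 - 2 * (x \<bullet> y)"
  using assms dot_norm_neg[of x y] by (simp add: dist_norm)

lemma norm_add_unit_square:
  fixes x y :: "'a::real_inner"
  assumes "norm x = 1" "norm y = 1"
  shows "(norm (x + y))\<^sup>2 = 2 + 2 * (x \<bullet> y)"
  using assms dot_norm[of x y] by simp

text \<open>Equality in the triangle inequality for unit vectors. It later yields uniqueness of
  nearest points and turns \<open>norm (l + N l) = 2\<close> into \<open>N l = l\<close>.\<close>

lemma unit_eq_if_norm_add_ge_2: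
  fixes x y :: "'a::real_inner"
  assumes "norm x = 1" "norm y = 1" "2 \<le> norm (x + y)"
  shows "x = y"
proof -
  have "4 \<le> (norm (x + y))\<^sup>2"
    using power_mono[OF assms(3), of 2] by simp
  also have "\<dots> = 2 + 2 * (x \<bullet> y)"
    using assms by (simp add: norm_add_unit_square)
  finally have "(dist x y)\<^sup>2 \<le> 0"
    using assms by (simp add: dist_unit_square)
  then show ?thesis by simp
qed

lemma norm_scaleR_sgn: "norm x *\<^sub>R sgn x = (x :: 'a::real_normed_vector)"
  by (cases "x = 0") (simp_all add: sgn_div_norm)

lemma model_dist_unit:
  assumes "norm x = 1" "norm y = 1"
  shows "model_dist k x y = arccos (x \<bullet> y) / sqrt k"
  using assms by (simp add: model_dist_def)

lemma model_dist_nonneg: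
  assumes "0 < k"
  shows "0 \<le> model_dist k x y"
  using Metric_space.nonneg[OF Metric_space_model[OF assms]] .

lemma model_dist_le_diam:
  assumes "0 < k"
  shows "model_dist k x y \<le> model_diam k"
  using assms inner_unit_bounds[of x y]
  by (auto simp: model_dist_def model_diam_def intro!: divide_right_mono arccos_ubound)

text \<open>The cosine decreases on \<open>{0..pi}\<close>, so bounds on the distance become
  reversed bounds on inner products. From here on the geometry is linear algebra.\<close>

lemma model_dist_less_iff:
  assumes "0 < k" "norm x = 1" "norm y = 1" "0 \<le> \<rho>" "\<rho> \<le> pi"
  shows "model_dist k x y < \<rho> / sqrt k \<longleftrightarrow> cos \<rho> < x \<bullet> y"
proof -
  have "model_dist k x y < \<rho> / sqrt k \<longleftrightarrow> arccos (x \<bullet> y) < arccos (cos \<rho>)"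
    using assms by (simp add: model_dist_unit divide_less_cancel arccos_cos)
  also have "\<dots> \<longleftrightarrow> cos \<rho> < x \<bullet> y"
    using inner_unit_bounds[OF assms(2,3)] by (intro arccos_less_mono) auto
  finally show ?thesis .
qed

lemma model_dist_le_iff:
  assumes "0 < k" "norm x = 1" "norm y = 1" "norm x' = 1" "norm y' = 1"
  shows "model_dist k x y \<le> model_dist k x' y' \<longleftrightarrow> x' \<bullet> y' \<le> x \<bullet> y"
proof -
  have "model_dist k x y \<le> model_dist k x' y' \<longleftrightarrow> arccos (x \<bullet> y) \<le> arccos (x' \<bullet> y')"
    using assms by (simp add: model_dist_unit divide_le_cancel)
  also have "\<dots> \<longleftrightarrow> x' \<bullet> y' \<le> x \<bullet> y"
    using inner_unit_bounds[OF assms(2,3)] inner_unit_bounds[OF assms(4,5)]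
    by (intro arccos_le_mono) auto
  finally show ?thesis .
qed

text \<open>Since \<open>(dist x y)\<^sup>2 = 2 - 2 * (x \<bullet> y)\<close>, spherical caps and
  Euclidean balls around a point of the sphere refine each other. Limits and closures may therefore
  be taken in the ambient space.\<close>

lemma model_topology_eq:
  assumes k: "0 < k"
  shows "model_topology k = top_of_set (model_space :: 'a::real_inner set)"
proof (rule topology_eq[THEN iffD2], intro allI)
  fix U :: "'a set"
  interpret Metric_space model_space "model_dist k :: 'a \<Rightarrow> 'a \<Rightarrow> real"
    by (rule Metric_space_model[OF k])
  have "(\<exists>r>0. mball x r \<subseteq> U) \<longleftrightarrow> (\<exists>e>0. \<forall>y\<in>model_space. dist y x < e \<longrightarrow> y \<in> U)"
    if x: "x \<in> model_space" for x
  proof safe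
    fix r :: real
    assume r: "0 < r" and sub: "mball x r \<subseteq> U"
    \<comment> \<open>The radius as an angle, capped at \<open>pi\<close> to stay where the cosine
      is monotone.\<close>
    define \<rho> where "\<rho> = min (r * sqrt k) pi"
    have \<rho>: "0 < \<rho>" "\<rho> \<le> pi" "\<rho> / sqrt k \<le> r"
      using r k by (auto simp: \<rho>_def pos_divide_le_eq)
    have cos: "cos \<rho> < 1"
      using cos_monotone_0_pi[of 0 \<rho>] \<rho> by simp
    \<comment> \<open>The Euclidean radius is the length of the chord subtending the angle
      \<open>\<rho>\<close>.\<close>
    have "y \<in> U" if y: "y \<in> model_space" "dist y x < sqrt (2 - 2 * cos \<rho>)" for y
    proof -
      have "(dist y x)\<^sup>2 < 2 - 2 * cos \<rho>"
        using power_strict_mono[OF y(2), of 2] cos by simp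
      then have "cos \<rho> < x \<bullet> y"
        using x y by (simp add: dist_unit_square inner_commute)
      then have "model_dist k x y < r"
        using model_dist_less_iff[of k x y \<rho>] x y \<rho> k by auto
      then show ?thesis
        using sub x y by auto
    qed
    then show "\<exists>e>0. \<forall>y\<in>model_space. dist y x < e \<longrightarrow> y \<in> U"
      using cos by (intro exI[of _ "sqrt (2 - 2 * cos \<rho>)"]) auto
  next
    fix e :: real
    assume e: "0 < e" and sub: "\<forall>y\<in>model_space. dist y x < e \<longrightarrow> y \<in> U"
    \<comment> \<open>Distance below \<open>e\<close> means inner product above
      \<open>1 - e\<^sup>2 / 2\<close>; the cap keeps \<open>a\<close> in the domain of
      \<open>arccos\<close>.\<close>
    define a where "a = max (-1) (1 - e\<^sup>2 / 2)"
    have a: "-1 \<le> a" "a < 1" "1 - e\<^sup>2 / 2 \<le> a"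
      using e by (auto simp: a_def)
    have "y \<in> U" if "y \<in> mball x (arccos a / sqrt k)" for y
    proof -
      have y: "norm y = 1" "model_dist k x y < arccos a / sqrt k"
        using that by auto
      have "a < x \<bullet> y"
        using model_dist_less_iff[of k x y "arccos a"] x y a k
        by (simp add: arccos_lbound arccos_ubound cos_arccos)
      then have "(dist y x)\<^sup>2 < e\<^sup>2"
        using x y a by (simp add: dist_unit_square inner_commute)
      then have "dist y x < e"
        using e by (simp add: power2_less_imp_less)
      then show ?thesis using sub y by auto
    qed
    moreover have "0 < arccos a / sqrt k"
      using a k arccos_less_arccos[of a 1] by simp
    ultimately show "\<exists>r>0. mball x r \<subseteq> U" by blast
  qed
  then show "openin (model_topology k) U \<longleftrightarrow> openin (top_of_set model_space) U"
    unfolding model_topology_def openin_mtopology openin_euclidean_subtopology_iff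
    by blast
qed

section \<open>Cluster points as limits of subsequences\<close>

lemma frequently_nhds_subsequence:
  fixes u :: "nat \<Rightarrow> 'a::metric_space"
  assumes "\<And>e. 0 < e \<Longrightarrow> \<exists>\<^sub>F n in sequentially. dist (u n) y < e"
  shows "\<exists>r. strict_mono r \<and> (u \<circ> r) \<longlonglongrightarrow> y"
proof -
  have "\<exists>n'. dist (u n') y < inverse (real (Suc (Suc i))) \<and> n < n'" for n i
    using assms[of "inverse (real (Suc (Suc i)))"] unfolding frequently_sequentially
    by (metis Suc_le_eq inverse_positive_iff_positive of_nat_0_less_iff zero_less_Suc)
  moreover have "\<exists>n. dist (u n) y < inverse (real (Suc 0))"
    using frequently_ex[OF assms[of 1]] by simp
  ultimately obtain r where r: "\<And>i. dist (u (r i)) y < inverse (real (Suc i))" "\<And>i. r i < r (Suc i)"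
    using dependent_nat_choice[of "\<lambda>i n. dist (u n) y < inverse (real (Suc i))" "\<lambda>_ n n'. n < n'"]
    by metis
  have "(\<lambda>i. dist (u (r i)) y) \<longlonglongrightarrow> 0"
    by (rule tendsto_sandwich[OF _ _ tendsto_const LIMSEQ_inverse_real_of_nat])
      (use r(1) in \<open>auto intro!: always_eventually less_imp_le\<close>)
  then have "(u \<circ> r) \<longlonglongrightarrow> y"
    by (subst tendsto_dist_iff) (simp add: o_def)
  moreover have "strict_mono r"
    using r(2) by (simp add: strict_mono_Suc_iff)
  ultimately show ?thesis by blast
qed

lemma cluster_point_subsequence:
  fixes u :: "nat \<Rightarrow> 'a::real_inner"
  assumes k: "0 < k" and y: "cluster_point k u y"
  shows "\<exists>r. strict_mono r \<and> (u \<circ> r) \<longlonglongrightarrow> y"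
proof (rule frequently_nhds_subsequence)
  fix e :: real
  assume "0 < e"
  then have "openin (model_topology k) (model_space \<inter> ball y e)" "y \<in> model_space \<inter> ball y e"
    using y by (auto simp: model_topology_eq[OF k] cluster_point_def openin_open_Int)
  then have "\<exists>\<^sub>F n in sequentially. u n \<in> model_space \<inter> ball y e"
    using y unfolding cluster_point_def by blast
  then show "\<exists>\<^sub>F n in sequentially. dist (u n) y < e"
    by (rule frequently_elim1) (simp add: dist_commute)
qed

section \<open>Distance and diameter bounds as bounds on inner products\<close>

lemma dist_to_set_less_imp_inner_pos:
  assumes k: "0 < k" and x: "norm x = 1" and S: "S \<noteq> {}" "S \<subseteq> model_space"
    and less: "dist_to_set k x S < model_diam k / 2"
  shows "\<exists>s\<in>S. 0 < x \<bullet> s"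
proof -
  have "\<exists>s\<in>S. model_dist k x s < model_diam k / 2"
    using cInf_lessD[OF _ less[unfolded dist_to_set_def]] S(1) by blast
  then obtain s where s: "s \<in> S" "model_dist k x s < pi / 2 / sqrt k"
    by (auto simp: model_diam_def)
  then show ?thesis
    using model_dist_less_iff[OF k x, of s "pi / 2"] S(2) by (auto simp: subset_iff)
qed

lemma inner_ge_if_set_diam_less:
  assumes k: "0 < k" and S: "S \<subseteq> model_space" and diam: "set_diam k S < model_diam k / 2"
  shows "\<exists>\<kappa>>0. \<forall>x\<in>S. \<forall>y\<in>S. \<kappa> \<le> x \<bullet> y"
proof -
  have scaled: "set_diam k S * sqrt k < pi / 2"
    using diam k by (simp add: model_diam_def field_simps)
  \<comment> \<open>The maximum with 0 also covers empty \<open>S\<close>, where the supremum is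
    unspecified.\<close>
  define \<delta> where "\<delta> = max 0 (set_diam k S * sqrt k)"
  have \<delta>: "0 \<le> \<delta>" "\<delta> < pi / 2"
    using scaled pi_gt_zero unfolding \<delta>_def max_def by (simp_all split: if_splits)
  have "cos \<delta> \<le> x \<bullet> y" if xy: "x \<in> S" "y \<in> S" for x y
  proof -
    have unit: "norm x = 1" "norm y = 1"
      using xy S by auto
    have "bdd_above ((\<lambda>(x, y). model_dist k x y) ` (S \<times> S))"
      using model_dist_le_diam[OF k] by (intro bdd_aboveI2[of _ _ "model_diam k"]) auto
    then have "model_dist k x y \<le> set_diam k S"
      unfolding set_diam_def using xy
      by (intro cSUP_upper2[of _ _ "(x, y)"]) auto
    then have "arccos (x \<bullet> y) \<le> \<delta>"
      using k by (simp add: model_dist_unit[OF unit] \<delta>_def pos_divide_le_eq le_max_iff_disj)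
    then have "cos \<delta> \<le> cos (arccos (x \<bullet> y))"
      using inner_unit_bounds[OF unit] \<delta>
      by (intro cos_monotone_0_pi_le) (auto simp: arccos_lbound)
    then show ?thesis
      using inner_unit_bounds[OF unit] by (simp add: cos_arccos)
  qed
  moreover have "0 < cos \<delta>"
    using \<delta> by (intro cos_gt_zero_pi) auto
  ultimately show ?thesis by blast
qed

section \<open>Geodesic segments and midpoints\<close>

text \<open>Great-circle arcs of angle at most \<open>pi\<close> are geodesic. An angle is
  \<open>sqrt k\<close> times a distance, hence the unit-speed parameter
  \<open>sqrt k * t\<close>.\<close>

lemma geodesic_segment_arc:
  fixes p u :: "'a::real_inner"
  assumes k: "0 < k" and p: "norm p = 1" and u: "norm u = 1" "p \<bullet> u = 0"
    and \<theta>: "0 \<le> \<theta>" "\<theta> \<le> pi"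
  shows "geodesic_segment k p (cos \<theta> *\<^sub>R p + sin \<theta> *\<^sub>R u)
    ((\<lambda>t. cos t *\<^sub>R p + sin t *\<^sub>R u) ` {0..\<theta>})"
proof -
  define \<gamma> where "\<gamma> t = cos t *\<^sub>R p + sin t *\<^sub>R u" for t
  have inner: "\<gamma> s \<bullet> \<gamma> t = cos (s - t)" for s t
    using p u
    by (simp add: \<gamma>_def inner_add inner_commute[of u p] dot_square_norm cos_diff)
  have unit: "norm (\<gamma> t) = 1" for t
    by (simp add: norm_eq_sqrt_inner inner)
  have dist: "model_dist k (\<gamma> s) (\<gamma> t) = \<bar>s - t\<bar> / sqrt k" if "\<bar>s - t\<bar> \<le> pi" for s t
    using that by (simp add: model_dist_unit unit inner arccos_cos_eq_abs)
  have \<gamma>0: "\<gamma> 0 = p" by (simp add: \<gamma>_def)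
  have end_dist: "model_dist k p (\<gamma> \<theta>) = \<theta> / sqrt k"
    using dist[of 0 \<theta>] \<theta> \<gamma>0 by simp
  have "geodesic_segment k p (\<gamma> \<theta>) (\<gamma> ` {0..\<theta>})"
    unfolding geodesic_segment_def end_dist
  proof (intro bexI[of _ "\<lambda>t. \<gamma> (sqrt k * t)"] conjI ballI)
    fix s t assume st: "s \<in> {0..\<theta> / sqrt k}" "t \<in> {0..\<theta> / sqrt k}"
    then have "0 \<le> sqrt k * s" "sqrt k * s \<le> \<theta>" "0 \<le> sqrt k * t" "sqrt k * t \<le> \<theta>"
      using k by (auto simp: field_simps)
    then have "\<bar>sqrt k * s - sqrt k * t\<bar> \<le> pi"
      using \<theta> by linarith
    moreover have "\<bar>sqrt k * s - sqrt k * t\<bar> / sqrt k = \<bar>s - t\<bar>"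
      using k by (simp add: right_diff_distrib[symmetric] abs_mult)
    ultimately show "model_dist k (\<gamma> (sqrt k * s)) (\<gamma> (sqrt k * t)) = \<bar>s - t\<bar>"
      by (simp add: dist)
  next
    have "(\<lambda>t. sqrt k * t) ` {0..\<theta> / sqrt k} = {0..\<theta>}"
      using k \<theta> by (simp add: image_mult_atLeastAtMost)
    then show "\<gamma> ` {0..\<theta>} = (\<lambda>t. \<gamma> (sqrt k * t)) ` {0..\<theta> / sqrt k}"
      by (metis image_image)
  qed (use k \<gamma>0 unit in auto)
  then show ?thesis
    by (simp add: \<gamma>_def)
qed

text \<open>In the orthonormal frame \<open>p\<close>, \<open>u\<close> of the plane of
  \<open>p\<close> and \<open>q\<close>, the combination is the point of the great circle at angle
  \<open>arccos d\<close> from \<open>p\<close>. Nonnegative coefficients place it between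
  \<open>p\<close> and \<open>q\<close>.\<close>

lemma unit_combination_on_geodesic_segment:
  fixes p q :: "'a::real_inner"
  assumes k: "0 < k" and p: "norm p = 1" and q: "norm q = 1" "q \<noteq> - p"
    and coeffs: "0 \<le> \<alpha>" "0 \<le> \<beta>" and w: "norm (\<alpha> *\<^sub>R p + \<beta> *\<^sub>R q) = 1"
  shows "\<exists>G. geodesic_segment k p q G \<and> \<alpha> *\<^sub>R p + \<beta> *\<^sub>R q \<in> G"
proof (cases "q = p")
  case True
  have "norm ((\<alpha> + \<beta>) *\<^sub>R p) = 1"
    using w True by (simp add: scaleR_add_left)
  then have "\<alpha> + \<beta> = 1"
    using p coeffs by simp
  then have "\<alpha> *\<^sub>R p + \<beta> *\<^sub>R q = p"
    using True by (metis scaleR_add_left scaleR_one)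
  moreover have "geodesic_segment k p q {p}"
    using True p by (auto simp: geodesic_segment_def model_dist_unit dot_square_norm)
  ultimately show ?thesis by blast
next
  case False
  define c where "c = p \<bullet> q"
  have pp: "p \<bullet> p = 1" and qq: "q \<bullet> q = 1"
    using p q by (simp_all add: dot_square_norm)
  have "c \<noteq> 1" "c \<noteq> -1"
    using dist_unit_square[of p q] dist_unit_square[of p "- q"] p q False
    by (auto simp: c_def dest: sym)
  then have c: "-1 < c" "c < 1"
    using inner_unit_bounds[OF p q(1)] by (auto simp: c_def)
  define \<theta> where "\<theta> = arccos c"
  have \<theta>: "0 \<le> \<theta>" "\<theta> \<le> pi" "cos \<theta> = c" "sin \<theta> = sqrt (1 - c\<^sup>2)"
    using c by (simp_all add: \<theta>_def arccos_lbound arccos_ubound sin_arccos cos_arccos)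
  have s: "0 < sin \<theta>"
    using c by (simp add: \<theta>(4) abs_square_less_1)
  have s2: "(sin \<theta>)\<^sup>2 = 1 - c\<^sup>2"
    using \<theta>(3) sin_squared_eq[of \<theta>] by simp
  define u where "u = (q - c *\<^sub>R p) /\<^sub>R sin \<theta>"
  have q_eq: "q = cos \<theta> *\<^sub>R p + sin \<theta> *\<^sub>R u"
    using s by (simp add: u_def \<theta>(3))
  have pu: "p \<bullet> u = 0"
    by (simp add: u_def inner_diff pp flip: c_def)
  have "(q - c *\<^sub>R p) \<bullet> (q - c *\<^sub>R p) = 1 - c\<^sup>2"
    by (simp add: inner_diff pp qq inner_commute[of q p] power2_eq_square flip: c_def)
  then have "norm (q - c *\<^sub>R p) = sin \<theta>"
    using s by (simp add: norm_eq_sqrt_inner flip: s2)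
  then have u: "norm u = 1"
    using s by (simp add: u_def)
  \<comment> \<open>The inner product of \<open>p\<close> with the combination, that is, the cosine
    of its angle from \<open>p\<close>.\<close>
  define d where "d = \<alpha> + \<beta> * c"
  have w_sq: "\<alpha>\<^sup>2 + 2 * \<alpha> * \<beta> * c + \<beta>\<^sup>2 = 1"
  proof -
    have "(norm (\<alpha> *\<^sub>R p + \<beta> *\<^sub>R q))\<^sup>2 = \<alpha>\<^sup>2 + 2 * \<alpha> * \<beta> * c + \<beta>\<^sup>2"
      unfolding power2_norm_eq_inner
      by (simp add: inner_add pp qq inner_commute[of q p] c_def power2_eq_square algebra_simps)
    then show ?thesis using w by simp
  qed
  have d_sq: "d\<^sup>2 = 1 - (\<beta> * sin \<theta>)\<^sup>2"
    using w_sq by (simp add: d_def s2 power_mult_distrib) (simp add: power2_eq_square algebra_simps)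
  have d1: "-1 \<le> d" "d \<le> 1"
    using d_sq abs_square_le_1[of d] by (simp_all add: abs_le_iff)
  \<comment> \<open>The arc length from \<open>p\<close> to the combination must not exceed \<open>\<theta>\<close>.\<close>
  have "c \<le> d"
  proof (cases "0 \<le> d")
    case d: True
    show ?thesis
    proof (cases "0 \<le> c")
      case True
      then have "0 \<le> 2 * \<alpha> * \<beta> * c" using coeffs by simp
      then have "\<beta>\<^sup>2 \<le> 1"
        using w_sq by (smt (verit) zero_le_power2)
      then have "c\<^sup>2 \<le> d\<^sup>2"
        using mult_right_mono[of "\<beta>\<^sup>2" 1 "(sin \<theta>)\<^sup>2"] s2 zero_le_power2[of "sin \<theta>"]
        unfolding d_sq power_mult_distrib by linarith
      then show ?thesis using d by (rule power2_le_imp_le)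
    qed (use d in simp)
  next
    case False
    then have "c \<le> 0"
      using coeffs by (smt (verit) d_def mult_nonneg_nonneg)
    have "\<alpha> * d \<le> 0" "\<alpha> * \<beta> * c \<le> 0"
      using False coeffs \<open>c \<le> 0\<close> by (simp_all add: mult_nonneg_nonpos)
    \<comment> \<open>The norm condition, regrouped so that the first two summands are
      nonpositive.\<close>
    moreover have "\<alpha> * d + \<alpha> * \<beta> * c + \<beta>\<^sup>2 = 1"
      using w_sq by (simp add: d_def power2_eq_square algebra_simps)
    ultimately have "1 \<le> \<beta>\<^sup>2"
      by linarith
    then have "(- d)\<^sup>2 \<le> (- c)\<^sup>2"
      using mult_right_mono[of 1 "\<beta>\<^sup>2" "(sin \<theta>)\<^sup>2"] s2 zero_le_power2[of "sin \<theta>"]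
      unfolding d_sq power2_minus power_mult_distrib by linarith
    then have "- d \<le> - c"
      by (rule power2_le_imp_le) (use \<open>c \<le> 0\<close> in simp)
    then show ?thesis by simp
  qed
  then have \<phi>: "arccos d \<in> {0..\<theta>}"
    using c d1 by (simp add: \<theta>_def arccos_lbound arccos_le_arccos)
  have "sin (arccos d) = \<beta> * sin \<theta>"
    using d1 d_sq coeffs s by (simp add: sin_arccos)
  then have "\<alpha> *\<^sub>R p + \<beta> *\<^sub>R q = cos (arccos d) *\<^sub>R p + sin (arccos d) *\<^sub>R u"
    using d1 by (subst q_eq) (simp add: d_def cos_arccos \<theta>(3) algebra_simps)
  then show ?thesis
    using geodesic_segment_arc[OF k p u pu \<theta>(1,2)] \<phi> q_eq by auto
qed

text \<open>Geodesic convexity in linear form: after division by the norm, a nonnegative combination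
  is a point of a geodesic segment. Later convexity arguments rest on this.\<close>

lemma geodesically_convex_sgn:
  fixes S :: "'a::real_inner set"
  assumes "0 < k" "geodesically_convex k S" "p \<in> S" "q \<in> S" "q \<noteq> - p"
    and "0 \<le> \<alpha>" "0 \<le> \<beta>" and nz: "\<alpha> *\<^sub>R p + \<beta> *\<^sub>R q \<noteq> 0"
  shows "sgn (\<alpha> *\<^sub>R p + \<beta> *\<^sub>R q) \<in> S"
proof -
  define n where "n = norm (\<alpha> *\<^sub>R p + \<beta> *\<^sub>R q)"
  have eq: "sgn (\<alpha> *\<^sub>R p + \<beta> *\<^sub>R q) = (\<alpha> / n) *\<^sub>R p + (\<beta> / n) *\<^sub>R q"
    by (simp add: sgn_div_norm n_def scaleR_add_right divide_inverse mult.commute)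
  have "norm ((\<alpha> / n) *\<^sub>R p + (\<beta> / n) *\<^sub>R q) = 1"
    using nz by (simp add: norm_sgn flip: eq)
  moreover have "norm p = 1" "norm q = 1"
    using assms(2-4) unfolding geodesically_convex_def by (meson mem_sphere_0 subsetD)+
  moreover have "0 \<le> \<alpha> / n" "0 \<le> \<beta> / n"
    using assms(6,7) by (simp_all add: n_def)
  ultimately obtain G where "geodesic_segment k p q G" "sgn (\<alpha> *\<^sub>R p + \<beta> *\<^sub>R q) \<in> G"
    unfolding eq using unit_combination_on_geodesic_segment[OF assms(1) _ _ assms(5)] by blast
  then show ?thesis
    using assms(2-4) unfolding geodesically_convex_def by blast
qed

lemma geodesic_segment_unit:
  assumes "0 < k" "geodesic_segment k x y G"
  shows "norm x = 1" "norm y = 1" "\<And>w. w \<in> G \<Longrightarrow> norm w = 1"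
proof -
  obtain c where c: "c \<in> {0..model_dist k x y} \<rightarrow> model_space"
      "c 0 = x" "c (model_dist k x y) = y" "G = c ` {0..model_dist k x y}"
    using assms(2) unfolding geodesic_segment_def by blast
  then have sub: "G \<subseteq> model_space" by blast
  moreover have "x \<in> G" "y \<in> G"
    unfolding c(4) using c(2,3) model_dist_nonneg[OF assms(1), of x y]
    by (metis atLeastAtMost_iff imageI order_refl)+
  ultimately show "norm x = 1" "norm y = 1" "\<And>w. w \<in> G \<Longrightarrow> norm w = 1"
    by auto
qed

text \<open>With \<open>h\<close> half the angle between \<open>x\<close> and \<open>y\<close>, a
  midpoint satisfies \<open>x \<bullet> w = y \<bullet> w = cos h\<close>, while
  \<open>norm (x + y) = 2 * cos h\<close>. This is the equality case of Cauchy-Schwarz for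
  \<open>w\<close> and \<open>x + y\<close>.\<close>

lemma is_midpoint_iff:
  fixes x y w :: "'a::real_inner"
  assumes k: "0 < k" and x: "norm x = 1" and y: "norm y = 1" "y \<noteq> - x"
  shows "is_midpoint k x y w \<longleftrightarrow> w = sgn (x + y)"
proof -
  define h where "h = arccos (x \<bullet> y) / 2"
  have bounds: "-1 \<le> x \<bullet> y" "x \<bullet> y \<le> 1"
    by (rule inner_unit_bounds[OF x y(1)])+
  then have h: "0 \<le> h" "h \<le> pi / 2"
    by (auto simp: h_def arccos_lbound arccos_ubound)
  have xy: "x \<bullet> y = 2 * (cos h)\<^sup>2 - 1"
    using bounds cos_double_cos[of h] by (simp add: h_def cos_arccos)
  have cos: "0 \<le> cos h"
    using h by (simp add: cos_ge_zero)
  have nz: "x + y \<noteq> 0"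
    using y by (metis add.commute eq_neg_iff_add_eq_0)
  have "(norm (x + y))\<^sup>2 = (2 * cos h)\<^sup>2"
    by (simp add: norm_add_unit_square x y(1) xy power_mult_distrib)
  then have norm: "norm (x + y) = 2 * cos h"
    by (rule power2_eq_imp_eq) (use cos in auto)
  have half: "model_dist k x y / 2 = h / sqrt k"
    using x y by (simp add: model_dist_unit h_def)
  show ?thesis
  proof
    assume "is_midpoint k x y w"
    then have w: "norm w = 1"
      and "model_dist k x w = h / sqrt k" "model_dist k y w = h / sqrt k"
      using geodesic_segment_unit(3)[OF k] unfolding is_midpoint_def half by blast+
    then have "arccos (x \<bullet> w) = h" "arccos (y \<bullet> w) = h"
      using x y k by (simp_all add: model_dist_unit)
    then have "x \<bullet> w = cos h" "y \<bullet> w = cos h"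
      using inner_unit_bounds[OF x w] inner_unit_bounds[OF y(1) w] cos_arccos by metis+
    then have "w \<bullet> (x + y) = norm w * norm (x + y)"
      by (simp add: norm w inner_add inner_commute)
    then have "x + y = norm (x + y) *\<^sub>R w"
      using norm_cauchy_schwarz_eq[of w "x + y"] w by simp
    then have "sgn (x + y) = sgn (norm (x + y) *\<^sub>R w)"
      by simp
    also have "\<dots> = w"
      using nz w by (simp add: sgn_div_norm)
    finally show "w = sgn (x + y)" ..
  next
    assume w: "w = sgn (x + y)"
    have w': "w = (1 / norm (x + y)) *\<^sub>R x + (1 / norm (x + y)) *\<^sub>R y"
      by (simp add: w sgn_div_norm scaleR_add_right divide_inverse)
    have unit: "norm w = 1"
      using nz by (simp add: w norm_sgn)
    have "0 < norm (x + y)"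
      using nz by simp
    then have cos_pos: "0 < cos h"
      using norm by simp
    obtain G where "geodesic_segment k x y G" "w \<in> G"
      using unit_combination_on_geodesic_segment[OF k x y, of "1 / norm (x + y)" "1 / norm (x + y)"]
        unit unfolding w' by auto
    moreover have "x \<bullet> w = cos h" "y \<bullet> w = cos h"
      using x y cos_pos
      by (simp_all add: w' norm inner_add dot_square_norm inner_commute[of y x] xy
          power2_eq_square field_simps)
    then have "model_dist k x w = h / sqrt k" "model_dist k y w = h / sqrt k"
      using x y unit h by (simp_all add: model_dist_unit arccos_cos)
    ultimately show "is_midpoint k x y w"
      unfolding is_midpoint_def half by blast
  qed
qed

lemma geodesic_midpoint_eq:
  assumes "0 < k" "norm x = 1" "norm y = 1" "y \<noteq> - x"
  shows "geodesic_midpoint k x y = sgn (x + y)"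
  using is_midpoint_iff[OF assms] by (simp add: geodesic_midpoint_def)

text \<open>If \<open>p\<close> is the midpoint, then \<open>x + z\<close> is a multiple of
  \<open>p\<close>, and \<open>norm z = 1\<close> fixes the factor. This shows that the reflected
  point exists and is unique.\<close>

lemma is_midpoint_reflection_iff:
  fixes x p z :: "'a::real_inner"
  assumes k: "0 < k" and x: "norm x = 1" and p: "norm p = 1" and pos: "0 < x \<bullet> p"
  shows "is_midpoint k x z p \<longleftrightarrow> z = (2 * (x \<bullet> p)) *\<^sub>R p - x"
proof -
  have unit: "x \<bullet> x = 1" "p \<bullet> p = 1"
    using x p by (simp_all add: dot_square_norm)
  have reflection_norm: "(norm (r *\<^sub>R p - x))\<^sup>2 = r\<^sup>2 - 2 * r * (x \<bullet> p) + 1" for r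
    unfolding power2_norm_eq_inner
    by (simp add: inner_diff unit inner_commute[of p x] power2_eq_square algebra_simps)
  show ?thesis
  proof
    assume mid: "is_midpoint k x z p"
    then have z: "norm z = 1" and half: "model_dist k x p = model_dist k x z / 2"
      using geodesic_segment_unit(2)[OF k] unfolding is_midpoint_def by blast+
    \<comment> \<open>For antipodal \<open>z\<close> the midpoint \<open>p\<close> would be at a
      right angle to \<open>x\<close>, against \<open>0 < x \<bullet> p\<close>.\<close>
    have "z \<noteq> - x"
    proof
      assume "z = - x"
      then have "model_dist k x z = pi / sqrt k"
        using x by (simp add: model_dist_unit dot_square_norm)
      moreover have "model_dist k x p < (pi / 2) / sqrt k"
        using model_dist_less_iff[OF k x p, of "pi / 2"] pos by simp
      ultimately show False
        using half by simp
    qed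
    then have "p = sgn (x + z)" "x + z \<noteq> 0"
      using is_midpoint_iff[OF k x z] mid by (auto simp: add_eq_0_iff)
    then have "norm (x + z) *\<^sub>R p = x + z"
      by (simp add: sgn_div_norm)
    then have z_eq: "z = norm (x + z) *\<^sub>R p - x"
      by simp
    define r where "r = norm (x + z)"
    have "(norm z)\<^sup>2 = r\<^sup>2 - 2 * r * (x \<bullet> p) + 1"
      using reflection_norm[of r] by (simp add: r_def flip: z_eq)
    \<comment> \<open>The root \<open>r = 0\<close> would again make \<open>z\<close> antipodal to
      \<open>x\<close>.\<close>
    then have "r * r = r * (2 * (x \<bullet> p))"
      using z by (simp add: power2_eq_square)
    then have "r = 2 * (x \<bullet> p)"
      using \<open>x + z \<noteq> 0\<close> by (simp add: r_def)
    then show "z = (2 * (x \<bullet> p)) *\<^sub>R p - x"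
      using z_eq by (simp add: r_def)
  next
    assume z: "z = (2 * (x \<bullet> p)) *\<^sub>R p - x"
    have "(norm z)\<^sup>2 = 1\<^sup>2"
      using reflection_norm[of "2 * (x \<bullet> p)"] by (simp add: z power2_eq_square)
    then have "norm z = 1"
      by (rule power2_eq_imp_eq) auto
    have sum: "x + z = (2 * (x \<bullet> p)) *\<^sub>R p"
      by (simp add: z)
    then have "x + z \<noteq> 0"
      using pos p by auto
    then have "z \<noteq> - x" by auto
    moreover have "sgn (x + z) = p"
      using pos p by (simp add: sum sgn_scaleR sgn_div_norm)
    ultimately show "is_midpoint k x z p"
      using is_midpoint_iff[OF k x \<open>norm z = 1\<close>] by simp
  qed
qed

section \<open>Projections and reflections\<close>

text \<open>Finite dimension makes \<open>S\<close> compact, which supplies nearest points.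
  Closedness is Euclidean, which for subsets of the sphere agrees with closedness in the model
  space.\<close>

locale closed_convex_subset =
  fixes k :: real and S :: "'a::euclidean_space set"
  assumes k_pos: "0 < k"
    and closed_S: "closed S"
    and convex_S: "geodesically_convex k S"
begin

text \<open>For unit vectors \<open>0 < x \<bullet> s\<close> says that \<open>x\<close> is at distance less than \<open>model_diam k / 2\<close> from \<open>s\<close>.\<close>

definition near :: "'a set" where
  "near = {x \<in> model_space. \<exists>s\<in>S. 0 < x \<bullet> s}"

lemma unit_S: "s \<in> S \<Longrightarrow> norm s = 1"
  using convex_S unfolding geodesically_convex_def by (meson mem_sphere_0 subsetD)

lemma unit_near: "x \<in> near \<Longrightarrow> norm x = 1"
  by (simp add: near_def)

lemma compact_S: "compact S"
  unfolding compact_eq_bounded_closed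
  using closed_S unit_S by (auto intro: boundedI[of _ 1])

text \<open>First-order optimality of \<open>p\<close> along the points \<open>sgn (p + t q)\<close> as \<open>t\<close> tends to 0.\<close>

lemma maximizer_variational:
  assumes p: "p \<in> S" and max: "\<And>q. q \<in> S \<Longrightarrow> x \<bullet> q \<le> x \<bullet> p"
    and pos: "0 < x \<bullet> p" and q: "q \<in> S"
  shows "x \<bullet> q \<le> (x \<bullet> p) * (p \<bullet> q)"
proof (cases "q = - p")
  \<comment> \<open>No particular segment joins antipodes, but here both sides equal
    \<open>- (x \<bullet> p)\<close>.\<close>
  case True
  then show ?thesis
    using unit_S[OF p] by (simp add: dot_square_norm)
next
  case False
  show ?thesis
  proof (rule field_le_epsilon)
    fix e :: real
    assume e: "0 < e"
    \<comment> \<open>Chosen so that the second-order error \<open>t / 2 * (x \<bullet> p)\<close>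
      is exactly \<open>e\<close>.\<close>
    define t where "t = 2 * e / (x \<bullet> p)"
    have t: "0 < t" using e pos by (simp add: t_def)
    have nz: "p + t *\<^sub>R q \<noteq> 0"
    proof
      assume "p + t *\<^sub>R q = 0"
      then have p_eq: "p = - (t *\<^sub>R q)"
        by (simp add: eq_neg_iff_add_eq_0)
      then have "norm p = t * norm q"
        using t by simp
      then have "t = 1"
        using unit_S[OF p] unit_S[OF q] by simp
      then show False using False p_eq by simp
    qed
    define n where "n = norm (p + t *\<^sub>R q)"
    have n: "0 < n" using nz by (simp add: n_def)
    have "sgn (p + t *\<^sub>R q) \<in> S"
      using geodesically_convex_sgn[OF k_pos convex_S p q False, of 1 t] t nz by simp
    then have "x \<bullet> sgn (p + t *\<^sub>R q) \<le> x \<bullet> p" by (rule max)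
    moreover have "x \<bullet> sgn (p + t *\<^sub>R q) = x \<bullet> (p + t *\<^sub>R q) / n"
      by (simp only: sgn_div_norm inner_scaleR_right n_def divide_inverse_commute)
    ultimately have "x \<bullet> (p + t *\<^sub>R q) \<le> n * (x \<bullet> p)"
      using n by (simp add: pos_divide_le_eq mult.commute)
    also have "\<dots> \<le> (1 + t * (p \<bullet> q) + t\<^sup>2 / 2) * (x \<bullet> p)"
    proof (rule mult_right_mono)
      have "n\<^sup>2 = 1 + 2 * t * (p \<bullet> q) + t\<^sup>2"
        using dot_norm[of p "t *\<^sub>R q"] unit_S[OF p] unit_S[OF q]
        by (simp add: n_def power_mult_distrib)
      \<comment> \<open>This gives \<open>n \<le> (1 + n\<^sup>2) / 2\<close>, a square-root-free
        upper bound on the norm.\<close>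
      moreover have "0 \<le> (n - 1)\<^sup>2" by simp
      ultimately show "n \<le> 1 + t * (p \<bullet> q) + t\<^sup>2 / 2"
        by (simp add: power2_diff)
    qed (use pos in simp)
    finally have "t * (x \<bullet> q) \<le> t * ((x \<bullet> p) * (p \<bullet> q) + t / 2 * (x \<bullet> p))"
      by (simp add: inner_add_right algebra_simps power2_eq_square)
    then have "x \<bullet> q \<le> (x \<bullet> p) * (p \<bullet> q) + t / 2 * (x \<bullet> p)"
      using t by (simp add: mult_le_cancel_left_pos)
    also have "t / 2 * (x \<bullet> p) = e"
      using pos by (simp add: t_def)
    finally show "x \<bullet> q \<le> (x \<bullet> p) * (p \<bullet> q) + e" .
  qed
qed

text \<open>Nearest points are the maximizers of \<open>x \<bullet> q\<close>; one exists by
  compactness. Two distinct maximizers have \<open>norm (p + p') < 2\<close>, so their midpoint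
  \<open>sgn (p + p')\<close> would do strictly better.\<close>

lemma proj_near:
  assumes x: "x \<in> near"
  shows "proj k S x \<in> S" "0 < x \<bullet> proj k S x"
    and "\<And>q. q \<in> S \<Longrightarrow> x \<bullet> q \<le> (x \<bullet> proj k S x) * (proj k S x \<bullet> q)"
proof -
  obtain s where s: "s \<in> S" "0 < x \<bullet> s"
    using x by (auto simp: near_def)
  have "continuous_on S (\<lambda>q. x \<bullet> q)"
    by (intro continuous_intros)
  then obtain p where p: "p \<in> S" and max: "\<And>q. q \<in> S \<Longrightarrow> x \<bullet> q \<le> x \<bullet> p"
    using continuous_attains_sup[OF compact_S] s(1) by blast
  have pos: "0 < x \<bullet> p"
    using s max[of s] by linarith
  have uniq: "p' = p" if p': "p' \<in> S" and max': "\<And>q. q \<in> S \<Longrightarrow> x \<bullet> q \<le> x \<bullet> p'" for p'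
  proof -
    have eq: "x \<bullet> p' = x \<bullet> p"
      using max[OF p'] max'[OF p] by simp
    then have "p' \<noteq> - p"
      using pos by auto
    then have nz: "p + p' \<noteq> 0"
      by (simp add: add_eq_0_iff)
    have "x \<bullet> sgn (p + p') \<le> x \<bullet> p"
      using geodesically_convex_sgn[OF k_pos convex_S p p' \<open>p' \<noteq> - p\<close>, of 1 1] nz max by simp
    then have "2 * (x \<bullet> p) \<le> norm (p + p') * (x \<bullet> p)"
      using nz eq by (simp add: sgn_div_norm inner_add_right field_simps)
    then have "2 \<le> norm (p + p')"
      using pos by simp
    then show ?thesis
      using unit_eq_if_norm_add_ge_2[OF unit_S[OF p] unit_S[OF p']] by simp
  qed
  have "proj k S x = p"
    unfolding proj_def
  proof (rule the_equality)
    show "p \<in> S \<and> (\<forall>y\<in>S. model_dist k x p \<le> model_dist k x y)"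
      using p max unit_S unit_near[OF x] by (simp add: model_dist_le_iff k_pos)
    show "p' = p" if "p' \<in> S \<and> (\<forall>y\<in>S. model_dist k x p' \<le> model_dist k x y)" for p'
      using that unit_S unit_near[OF x] by (intro uniq) (auto simp: model_dist_le_iff k_pos)
  qed
  then show "proj k S x \<in> S" "0 < x \<bullet> proj k S x"
    and "\<And>q. q \<in> S \<Longrightarrow> x \<bullet> q \<le> (x \<bullet> proj k S x) * (proj k S x \<bullet> q)"
    using p pos maximizer_variational[OF p max pos] by auto
qed

lemma refl_in_near:
  assumes x: "x \<in> near"
  shows "refl_in k S x = (2 * (x \<bullet> proj k S x)) *\<^sub>R proj k S x - x"
  using is_midpoint_reflection_iff[OF k_pos unit_near[OF x] unit_S proj_near(2)[OF x]]
    proj_near(1)[OF x] by (simp add: refl_in_def)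

text \<open>Expresses the projection through the reflection; continuity of the projection and the
  coincidence of the two projections at a fixed point follow from it.\<close>

lemma sgn_add_refl_in:
  assumes x: "x \<in> near"
  shows "x + refl_in k S x \<noteq> 0" "sgn (x + refl_in k S x) = proj k S x"
proof -
  define p where "p = proj k S x"
  have sum: "x + refl_in k S x = (2 * (x \<bullet> p)) *\<^sub>R p"
    by (simp add: refl_in_near[OF x] p_def)
  have p: "norm p = 1" "0 < x \<bullet> p"
    using proj_near[OF x] unit_S by (simp_all add: p_def)
  show "x + refl_in k S x \<noteq> 0"
    unfolding sum using p by auto
  show "sgn (x + refl_in k S x) = proj k S x"
    unfolding sum p_def[symmetric] using p by (simp add: sgn_div_norm)
qed

lemma norm_refl_in:
  assumes x: "x \<in> near"
  shows "norm (refl_in k S x) = 1"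
proof -
  define p where "p = proj k S x"
  have unit: "x \<bullet> x = 1" "p \<bullet> p = 1"
    using unit_near[OF x] unit_S[OF proj_near(1)[OF x]] by (simp_all add: p_def dot_square_norm)
  have "refl_in k S x \<bullet> refl_in k S x = 1"
    unfolding refl_in_near[OF x] p_def[symmetric]
    by (simp add: inner_diff unit inner_commute[of p x])
  then show ?thesis by (simp add: norm_eq_sqrt_inner)
qed

text \<open>Expanding \<open>refl_in k S x \<bullet> refl_in k S y\<close> leaves
  \<open>x \<bullet> y\<close> plus twice the slacks \<open>c\<close> and \<open>d\<close> of the
  two variational inequalities, each tested at the other projection.\<close>

lemma dist_refl_in_le:
  assumes x: "x \<in> near" and y: "y \<in> near"
  shows "dist (refl_in k S x) (refl_in k S y) \<le> dist x y"
proof -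
  define p q where "p = proj k S x" and "q = proj k S y"
  define a b where "a = x \<bullet> p" and "b = y \<bullet> q"
  have pos: "0 < a" "0 < b"
    using proj_near(2) x y by (simp_all add: a_def b_def p_def q_def)
  have le: "x \<bullet> q \<le> a * (p \<bullet> q)" "y \<bullet> p \<le> b * (p \<bullet> q)"
    using proj_near(3)[OF x proj_near(1)[OF y]] proj_near(3)[OF y proj_near(1)[OF x]]
    by (simp_all add: a_def b_def p_def q_def inner_commute)
  define c d where "c = b * (a * (p \<bullet> q) - x \<bullet> q)" and "d = a * (b * (p \<bullet> q) - y \<bullet> p)"
  have "0 \<le> c" "0 \<le> d"
    using pos le by (simp_all add: c_def d_def)
  moreover have "refl_in k S x \<bullet> refl_in k S y = x \<bullet> y + 2 * c + 2 * d"
    unfolding refl_in_near[OF x] refl_in_near[OF y] p_def[symmetric] q_def[symmetric]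
      a_def[symmetric] b_def[symmetric] c_def d_def
    by (simp add: inner_diff inner_commute[of p y] algebra_simps)
  ultimately have "x \<bullet> y \<le> refl_in k S x \<bullet> refl_in k S y"
    by linarith
  then have "(dist (refl_in k S x) (refl_in k S y))\<^sup>2 \<le> (dist x y)\<^sup>2"
    using x y by (simp add: dist_unit_square norm_refl_in unit_near)
  then show ?thesis
    by (rule power2_le_imp_le) simp
qed

lemma continuous_on_refl_in: "continuous_on near (refl_in k S)"
  unfolding continuous_on_iff by (meson dist_refl_in_le le_less_trans)

lemma continuous_on_proj: "continuous_on near (proj k S)"
proof (rule continuous_on_eq)
  show "continuous_on near (\<lambda>x. sgn (x + refl_in k S x))"
    by (intro continuous_intros continuous_on_refl_in) (auto simp: sgn_add_refl_in)
qed (simp add: sgn_add_refl_in)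

end

section \<open>Averaged alternating reflections\<close>

text \<open>\<open>\<kappa>\<close> is the cosine form of the diameter bound: any two points of
  \<open>C\<close> are at an angle of at most \<open>arccos \<kappa>\<close>, below a right angle.
  \<open>C\<close> is not assumed closed, so the maps are studied on \<open>closure C\<close>, where
  limits of iterates lie.\<close>

locale alternating_reflections =
  A: closed_convex_subset k A + B: closed_convex_subset k B for k and A B :: "'a::euclidean_space set" +
  fixes C :: "'a set" and \<kappa> :: real
  assumes convex_C: "geodesically_convex k C"
    and C_nonempty: "C \<noteq> {}"
    and A_nonempty: "A \<noteq> {}"
    and B_nonempty: "B \<noteq> {}"
    and B_subset_C: "B \<subseteq> C"
    and \<kappa>_pos: "0 < \<kappa>"
    and inner_C: "\<And>x y. x \<in> C \<Longrightarrow> y \<in> C \<Longrightarrow> \<kappa> \<le> x \<bullet> y"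
    and refl_refl_C: "(refl_in k A \<circ> refl_in k B) ` C \<subseteq> C"
    and dist_refl: "\<And>z. z \<in> closure C \<Longrightarrow> dist_to_set k (refl_in k B z) A < model_diam k / 2"
begin

abbreviation N :: "'a \<Rightarrow> 'a" where
  "N \<equiv> refl_in k A \<circ> refl_in k B"

abbreviation T :: "'a \<Rightarrow> 'a" where
  "T \<equiv> AAR k A B"

lemma closure_unit: "z \<in> closure C \<Longrightarrow> norm z = 1"
proof -
  have "closure C \<subseteq> model_space"
    using convex_C unfolding geodesically_convex_def by (intro closure_minimal) auto
  then show "z \<in> closure C \<Longrightarrow> norm z = 1" by auto
qed

lemma inner_closure:
  assumes "x \<in> closure C" "y \<in> closure C"
  shows "\<kappa> \<le> x \<bullet> y"
proof -
  have "closure C \<subseteq> {x. \<kappa> \<le> x \<bullet> y}" if "y \<in> C" for y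
    using inner_C that
    by (intro closure_minimal closed_Collect_le continuous_intros) auto
  then have "closure C \<subseteq> {y. \<kappa> \<le> x \<bullet> y}" if "x \<in> closure C" for x
    using that by (intro closure_minimal closed_Collect_le continuous_intros) auto
  then show ?thesis using assms by blast
qed

lemma near_closure: "z \<in> closure C \<Longrightarrow> z \<in> B.near"
proof -
  assume z: "z \<in> closure C"
  obtain b where b: "b \<in> B" using B_nonempty by blast
  then have "0 < z \<bullet> b"
    using inner_closure[OF z, of b] B_subset_C closure_subset[of C] \<kappa>_pos by fastforce
  then show "z \<in> B.near"
    using b closure_unit[OF z] by (auto simp: B.near_def)
qed

lemma near_refl: "z \<in> closure C \<Longrightarrow> refl_in k B z \<in> A.near"
  using dist_to_set_less_imp_inner_pos[OF A.k_pos B.norm_refl_in A_nonempty _ dist_refl]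
    A.unit_S B.norm_refl_in near_closure
  by (auto simp: A.near_def subset_iff)

lemma continuous_on_N: "continuous_on (closure C) N"
  by (intro continuous_on_compose continuous_on_subset[OF B.continuous_on_refl_in]
      continuous_on_subset[OF A.continuous_on_refl_in]) (auto simp: near_closure near_refl)

lemma N_closure: "z \<in> closure C \<Longrightarrow> N z \<in> closure C"
  using image_closure_subset[OF continuous_on_N closed_closure] refl_refl_C closure_subset[of C]
  by blast

lemma dist_N_le: "x \<in> closure C \<Longrightarrow> y \<in> closure C \<Longrightarrow> dist (N x) (N y) \<le> dist x y"
  using A.dist_refl_in_le[OF near_refl near_refl] B.dist_refl_in_le[OF near_closure near_closure]
  by (metis comp_apply order_trans)

lemma inner_le_inner_N:
  assumes "x \<in> closure C" "y \<in> closure C"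
  shows "x \<bullet> y \<le> N x \<bullet> N y"
  using power_mono[OF dist_N_le[OF assms], of 2] assms
  by (simp add: dist_unit_square closure_unit N_closure del: comp_apply)

text \<open>Excludes the only case in which the midpoint of \<open>z\<close> and \<open>N z\<close>
  would be ambiguous.\<close>

lemma closure_not_antipodal:
  assumes "x \<in> closure C" "y \<in> closure C"
  shows "y \<noteq> - x"
proof
  assume "y = - x"
  then have "\<kappa> \<le> - (x \<bullet> x)"
    using inner_closure[OF assms] by simp
  then show False
    using \<kappa>_pos inner_ge_zero[of x] by linarith
qed

lemma T_eq:
  assumes "z \<in> closure C"
  shows "z + N z \<noteq> 0" "T z = sgn (z + N z)"
proof -
  have *: "N z \<noteq> - z"
    using closure_not_antipodal[OF assms N_closure[OF assms]] .
  then show "z + N z \<noteq> 0"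
    by (metis add_eq_0_iff)
  show "T z = sgn (z + N z)"
    using geodesic_midpoint_eq[OF A.k_pos closure_unit[OF assms] closure_unit[OF N_closure[OF assms]] *]
    by (simp add: AAR_def)
qed

lemma continuous_on_T: "continuous_on (closure C) T"
proof (rule continuous_on_eq)
  show "continuous_on (closure C) (\<lambda>z. sgn (z + N z))"
    using T_eq(1) by (intro continuous_intros continuous_on_N) auto
qed (simp add: T_eq(2))

lemma sgn_combination_C:
  assumes "x \<in> C" "y \<in> C" "0 \<le> \<alpha>" "0 \<le> \<beta>" "\<alpha> *\<^sub>R x + \<beta> *\<^sub>R y \<noteq> 0"
  shows "sgn (\<alpha> *\<^sub>R x + \<beta> *\<^sub>R y) \<in> C"
  using geodesically_convex_sgn[OF A.k_pos convex_C assms(1,2) _ assms(3-5)]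
    closure_not_antipodal assms(1,2) closure_subset[of C] by blast

lemma T_C: "z \<in> C \<Longrightarrow> T z \<in> C"
  using T_eq[of z] sgn_combination_C[of z "N z" 1 1] refl_refl_C closure_subset[of C]
  by (auto simp: subset_iff)

lemma T_closure: "z \<in> closure C \<Longrightarrow> T z \<in> closure C"
  using image_closure_subset[OF continuous_on_T closed_closure] T_C closure_subset[of C]
  by blast

section \<open>Fixed points of \<open>T\<close> and \<open>N\<close>\<close>

text \<open>The cone over \<open>C\<close>, cut by a half-space that misses the origin, is convex in
  the linear sense. Hence \<open>sgn\<close> retracts the convex hull onto \<open>C\<close>, which
  carries \<open>T\<close> over to a set fit for Brouwer's theorem.\<close>

lemma sgn_convex_hull:
  assumes "x \<in> convex hull C"
  shows "sgn x \<in> C"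
proof -
  obtain e where e: "e \<in> C" using C_nonempty by blast
  have sgn_C: "sgn z = z" if "z \<in> C" for z
    using that closure_unit closure_subset[of C] by (auto simp: sgn_div_norm)
  define Q where "Q = {q. \<kappa> \<le> e \<bullet> q \<and> sgn q \<in> C}"
  have "convex Q"
  proof (rule convexI)
    fix a b and u v :: real
    assume ab: "a \<in> Q" "b \<in> Q" and uv: "0 \<le> u" "0 \<le> v" "u + v = 1"
    have "\<kappa> = u * \<kappa> + v * \<kappa>"
      using uv by (simp flip: distrib_right)
    also have "\<dots> \<le> u * (e \<bullet> a) + v * (e \<bullet> b)"
      using ab uv by (intro add_mono mult_left_mono) (auto simp: Q_def)
    finally have inner: "\<kappa> \<le> e \<bullet> (u *\<^sub>R a + v *\<^sub>R b)"
      by (simp add: inner_add_right)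
    then have nz: "u *\<^sub>R a + v *\<^sub>R b \<noteq> 0"
      using \<kappa>_pos by auto
    \<comment> \<open>The combination rewritten in terms of the points \<open>sgn a\<close> and
      \<open>sgn b\<close> of \<open>C\<close>.\<close>
    have eq: "(u * norm a) *\<^sub>R sgn a + (v * norm b) *\<^sub>R sgn b = u *\<^sub>R a + v *\<^sub>R b"
      by (simp add: norm_scaleR_sgn flip: scaleR_scaleR)
    have "sgn ((u * norm a) *\<^sub>R sgn a + (v * norm b) *\<^sub>R sgn b) \<in> C"
      using ab uv nz unfolding Q_def by (intro sgn_combination_C) (auto simp only: eq, auto)
    then show "u *\<^sub>R a + v *\<^sub>R b \<in> Q"
      using inner unfolding eq Q_def by simp
  qed
  moreover have "C \<subseteq> Q"
    using e inner_C sgn_C by (auto simp: Q_def)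
  ultimately have "convex hull C \<subseteq> Q"
    by (intro hull_minimal)
  then show ?thesis
    using assms by (auto simp: Q_def)
qed

text \<open>Brouwer's theorem is applied to \<open>T \<circ> sgn\<close> on the closed convex hull of \<open>C\<close> in the ambient
  vector space.\<close>

lemma fixed_point_T: "\<exists>f\<in>closure C. T f = f"
proof -
  define Q where "Q = closure (convex hull C)"
  obtain e where e: "e \<in> C" using C_nonempty by blast
  have C_Q: "closure C \<subseteq> Q"
    unfolding Q_def by (intro closure_mono hull_subset)
  have "bounded C"
    using closure_unit closure_subset[of C] by (intro boundedI[of _ 1]) fastforce
  then have "compact Q" "convex Q" "Q \<noteq> {}"
    using C_nonempty
    by (auto simp: Q_def compact_closure bounded_convex_hull convex_closure closure_eq_empty)
  \<comment> \<open>The half-space \<open>\<kappa> \<le> e \<bullet> x\<close> keeps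
    \<open>Q\<close> away from 0, where \<open>sgn\<close> is discontinuous.\<close>
  moreover have Q0: "x \<noteq> 0" if "x \<in> Q" for x
  proof -
    have "convex hull C \<subseteq> {x. \<kappa> \<le> e \<bullet> x}"
      using inner_C[OF e] by (intro hull_minimal) (auto simp: convex_halfspace_ge)
    then have "Q \<subseteq> {x. \<kappa> \<le> e \<bullet> x}"
      unfolding Q_def by (rule closure_minimal) (intro closed_Collect_le continuous_intros)
    then show ?thesis using that \<kappa>_pos by auto
  qed
  have cont: "continuous_on Q sgn"
    using Q0 by (intro continuous_intros) auto
  have sgn_Q: "sgn ` Q \<subseteq> closure C"
    unfolding Q_def
    using cont sgn_convex_hull closure_subset[of C]
    by (intro image_closure_subset) (auto simp: Q_def)
  have "continuous_on Q (T \<circ> sgn)"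
    using cont sgn_Q continuous_on_subset[OF continuous_on_T] by (intro continuous_on_compose)
  moreover have "(T \<circ> sgn) \<in> Q \<rightarrow> Q"
    using sgn_Q T_closure C_Q by fastforce
  ultimately obtain f where f: "f \<in> Q" "T (sgn f) = f"
    using brouwer[of Q "T \<circ> sgn"] by auto
  then have "f \<in> closure C"
    using sgn_Q T_closure by (metis image_subset_iff)
  moreover from this have "sgn f = f"
    using closure_unit by (simp add: sgn_div_norm)
  ultimately show ?thesis using f by auto
qed

lemma N_fixed_if_norm_ge_2:
  assumes "z \<in> closure C" "2 \<le> norm (z + N z)"
  shows "N z = z"
  using unit_eq_if_norm_add_ge_2 closure_unit N_closure assms by metis

text \<open>A fixed point of \<open>T\<close> satisfies \<open>N z = (r - 1) *\<^sub>R z\<close>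
  with \<open>r > 0\<close>; since both are unit vectors, \<open>r = 2\<close>.\<close>

lemma N_fixed_if_T_fixed:
  assumes z: "z \<in> closure C" and fix_T: "T z = z"
  shows "N z = z"
proof -
  define r where "r = norm (z + N z)"
  have r: "0 < r" using T_eq(1)[OF z] by (simp add: r_def)
  have "r *\<^sub>R z = r *\<^sub>R sgn (z + N z)"
    using fix_T T_eq(2)[OF z] by simp
  also have "\<dots> = z + N z"
    by (simp only: r_def norm_scaleR_sgn)
  finally have "N z = (r - 1) *\<^sub>R z"
    by (simp add: algebra_simps)
  then have "norm ((r - 1) *\<^sub>R z) = 1"
    using closure_unit[OF N_closure[OF z]] by simp
  then have "r = 2"
    using r closure_unit[OF z] by (auto simp: abs_if split: if_splits)
  then show ?thesis
    using N_fixed_if_norm_ge_2[OF z] by (simp add: r_def)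
qed

lemma T_fixed_if_N_fixed:
  assumes z: "z \<in> closure C" and fix_N: "N z = z"
  shows "T z = z"
proof -
  have "z + z = 2 *\<^sub>R z" by (simp add: scaleR_2)
  then show ?thesis
    using T_eq(2)[OF z] fix_N closure_unit[OF z] by (simp add: sgn_div_norm del: comp_apply)
qed

text \<open>When \<open>N z = z\<close>, both projections are the normalised sum of \<open>z\<close>
  and \<open>refl_in k B z\<close>, so one point lies in both sets.\<close>

lemma proj_in_Int_if_N_fixed:
  assumes z: "z \<in> closure C" and fix_N: "N z = z"
  shows "proj k B z \<in> A \<inter> B"
proof -
  have "proj k A (refl_in k B z) = sgn (refl_in k B z + z)"
    using A.sgn_add_refl_in(2)[OF near_refl[OF z]] fix_N by simp
  also have "\<dots> = proj k B z"
    using B.sgn_add_refl_in(2)[OF near_closure[OF z]] by (simp add: add.commute)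
  finally show ?thesis
    using A.proj_near(1)[OF near_refl[OF z]] B.proj_near(1)[OF near_closure[OF z]] by simp
qed

text \<open>The linear functional given by a fixed point is a Lyapunov function: it grows strictly
  unless \<open>N z = z\<close>.\<close>

lemma inner_fixed_point_T:
  assumes f: "f \<in> closure C" "N f = f" and z: "z \<in> closure C"
  shows "2 * (z \<bullet> f) \<le> norm (z + N z) * (T z \<bullet> f)"
proof -
  have "norm (z + N z) *\<^sub>R T z = z + N z"
    using T_eq(2)[OF z] by (simp only: norm_scaleR_sgn)
  then have "norm (z + N z) * (T z \<bullet> f) = z \<bullet> f + N z \<bullet> f"
    by (metis inner_add_left inner_scaleR_left)
  then show ?thesis
    using inner_le_inner_N[OF z f(1)] f(2) by (simp del: comp_apply)
qed

section \<open>Orbits of \<open>T\<close> and their subsequential limits\<close>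

context
  fixes x :: "nat \<Rightarrow> 'a"
  assumes x_0: "x 0 \<in> C" and x_Suc: "\<And>n. x (Suc n) = T (x n)"
begin

lemma iterate_C: "x n \<in> C"
  by (induction n) (simp_all add: x_0 x_Suc T_C)

lemma iterate_closure: "x n \<in> closure C"
  using iterate_C closure_subset by blast

text \<open>Since \<open>norm (z + N z) \<le> 2\<close> and inner products on
  \<open>closure C\<close> are positive, the Lyapunov inequality makes the sequence increasing; it
  is bounded by 1.\<close>

lemma convergent_inner_iterate:
  assumes f: "f \<in> closure C" "N f = f"
  shows "convergent (\<lambda>n. x n \<bullet> f)"
proof (rule Bseq_monoseq_convergent)
  show "Bseq (\<lambda>n. x n \<bullet> f)"
  proof (rule BseqI'[where K = 1])
    fix n
    show "norm (x n \<bullet> f) \<le> 1"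
      using Cauchy_Schwarz_ineq2[of "x n" f] closure_unit[OF iterate_closure] closure_unit[OF f(1)]
      by simp
  qed
  show "monoseq (\<lambda>n. x n \<bullet> f)"
  proof (rule mono_SucI1, rule allI)
    fix n
    have "norm (x n + N (x n)) \<le> 2"
      using norm_triangle_ineq[of "x n" "N (x n)"] closure_unit iterate_closure N_closure by fastforce
    moreover have "0 < x (Suc n) \<bullet> f"
      using inner_closure[OF iterate_closure f(1), of "Suc n"] \<kappa>_pos by simp
    ultimately have "norm (x n + N (x n)) * (x (Suc n) \<bullet> f) \<le> 2 * (x (Suc n) \<bullet> f)"
      by (intro mult_right_mono) auto
    then show "x n \<bullet> f \<le> x (Suc n) \<bullet> f"
      using inner_fixed_point_T[OF f iterate_closure, of n] by (simp add: x_Suc del: comp_apply)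
  qed
qed

lemma subsequence_limit_N_fixed:
  assumes r: "strict_mono r" and lim: "(x \<circ> r) \<longlonglongrightarrow> l"
  shows "l \<in> closure C" "N l = l"
proof -
  show l: "l \<in> closure C"
    using closed_sequentially[OF closed_closure _ lim] iterate_closure by simp
  obtain f where f: "f \<in> closure C" "N f = f"
    using fixed_point_T N_fixed_if_T_fixed by blast
  obtain a where a: "(\<lambda>n. x n \<bullet> f) \<longlonglongrightarrow> a"
    using convergent_inner_iterate[OF f] by (auto simp: convergent_def)
  have "(\<lambda>n. T (x (r n))) \<longlonglongrightarrow> T l"
    using continuous_on_tendsto_compose[OF continuous_on_T _ l, of "x \<circ> r" sequentially] lim iterate_closure
    by simp
  then have "(\<lambda>n. T (x (r n)) \<bullet> f) \<longlonglongrightarrow> T l \<bullet> f"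
    by (intro tendsto_intros)
  \<comment> \<open>\<open>T (x (r n))\<close> is \<open>x (Suc (r n))\<close>, a subsequence of the
    shifted orbit, so the limit is the same.\<close>
  moreover have "(\<lambda>n. T (x (r n)) \<bullet> f) \<longlonglongrightarrow> a"
    using LIMSEQ_subseq_LIMSEQ[OF LIMSEQ_Suc[OF a] r] by (simp add: o_def x_Suc)
  ultimately have "T l \<bullet> f = a"
    by (rule LIMSEQ_unique)
  moreover have "l \<bullet> f = a"
  proof (rule LIMSEQ_unique)
    show "(\<lambda>n. x (r n) \<bullet> f) \<longlonglongrightarrow> l \<bullet> f"
      using lim by (intro tendsto_intros) (simp add: o_def)
    show "(\<lambda>n. x (r n) \<bullet> f) \<longlonglongrightarrow> a"
      using LIMSEQ_subseq_LIMSEQ[OF a r] by (simp add: o_def)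
  qed
  \<comment> \<open>The functional does not grow from \<open>l\<close> to \<open>T l\<close>;
    cancelling \<open>l \<bullet> f > 0\<close> leaves
    \<open>norm (l + N l) \<ge> 2\<close>.\<close>
  ultimately have "2 * (l \<bullet> f) \<le> norm (l + N l) * (l \<bullet> f)"
    using inner_fixed_point_T[OF f l] by simp
  moreover have "0 < l \<bullet> f"
    using inner_closure[OF l f(1)] \<kappa>_pos by simp
  ultimately show "N l = l"
    by (intro N_fixed_if_norm_ge_2[OF l]) simp
qed

text \<open>By compactness the orbit itself converges along a further subsequence, to some
  \<open>l\<close>; continuity of the projection then gives \<open>y = proj k B l\<close>.\<close>

lemma shadow_subsequence_limit:
  assumes r: "strict_mono r" and lim: "(\<lambda>n. proj k B (x (r n))) \<longlonglongrightarrow> y"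
  shows "y \<in> A \<inter> B"
proof -
  have "compact (closure C)"
    using closure_unit by (auto simp: compact_eq_bounded_closed intro: boundedI[of _ 1])
  then obtain l s where l: "l \<in> closure C" and s: "strict_mono s" and "((x \<circ> r) \<circ> s) \<longlonglongrightarrow> l"
    using iterate_closure unfolding compact_def by (metis comp_apply)
  then have lim_rs: "(x \<circ> (r \<circ> s)) \<longlonglongrightarrow> l"
    by (simp add: o_assoc)
  have "(\<lambda>n. proj k B ((x \<circ> (r \<circ> s)) n)) \<longlonglongrightarrow> proj k B l"
    using continuous_on_tendsto_compose[OF B.continuous_on_proj lim_rs] near_closure l iterate_closure
    by simp
  moreover have "(\<lambda>n. proj k B ((x \<circ> (r \<circ> s)) n)) \<longlonglongrightarrow> y"
    using LIMSEQ_subseq_LIMSEQ[OF lim s] by (simp add: o_def)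
  ultimately have "y = proj k B l"
    using LIMSEQ_unique by blast
  then show ?thesis
    using subsequence_limit_N_fixed[OF strict_mono_o[OF r s] lim_rs] proj_in_Int_if_N_fixed by simp
qed

end

end

theorem theorem3p6:
  fixes k :: real and m :: nat
    and A B C :: "(real ^ 'n) set"
    and x0 :: "real ^ 'n" and x :: "nat \<Rightarrow> real ^ 'n"
  assumes k: "k > 0"
    and dim: "CARD('n) = m + 1"
    and A: "A \<noteq> {}" "closedin (model_topology k) A" "geodesically_convex k A"
    and B: "B \<noteq> {}" "closedin (model_topology k) B" "geodesically_convex k B"
    and C: "C \<noteq> {}" "geodesically_convex k C" "set_diam k C < model_diam k / 2"
    and sub: "A \<subseteq> C" "B \<subseteq> C"
    and inv: "(refl_in k A \<circ> refl_in k B) ` C \<subseteq> C"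
    and well_defined:
      "\<And>z. z \<in> model_topology k closure_of C \<Longrightarrow>
         dist_to_set k (refl_in k B z) A < model_diam k / 2"
    and x0: "x0 \<in> C"
    and x: "\<And>n. x n = (AAR k A B ^^ n) x0"
  shows "(\<forall>r l. strict_mono r \<and> limitin (model_topology k) (x \<circ> r) l sequentially \<longrightarrow>
            AAR k A B l = l \<and> proj k B l \<in> A \<inter> B)
       \<and> (Metric_space.mbounded model_space (model_dist k) (range (\<lambda>n. proj k B (x n)))
          \<and> (\<forall>y. cluster_point k (\<lambda>n. proj k B (x n)) y \<longrightarrow> y \<in> A \<inter> B))"
proof -
  note top = model_topology_eq[OF k]
  have spheres: "A \<subseteq> model_space" "B \<subseteq> model_space" "C \<subseteq> model_space"
    using A B C by (simp_all add: geodesically_convex_def)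
  have "closed A" "closed B"
    using A(2) B(2) closedin_closed_trans[OF _ closed_sphere] by (simp_all add: top)
  then interpret A: closed_convex_subset k A + B: closed_convex_subset k B
    using k A(3) B(3) by unfold_locales
  obtain \<kappa> where \<kappa>: "0 < \<kappa>" "\<And>x y. x \<in> C \<Longrightarrow> y \<in> C \<Longrightarrow> \<kappa> \<le> x \<bullet> y"
    using inner_ge_if_set_diam_less[OF k spheres(3) C(3)] by blast
  \<comment> \<open>The sphere is closed, so the Euclidean closure stays inside it and the
    well-definedness hypothesis transfers.\<close>
  have closure: "model_topology k closure_of C = closure C"
    using closure_minimal[OF spheres(3) closed_sphere] spheres(3)
    by (simp add: top closure_of_subtopology inf_absorb2)
  interpret alternating_reflections k A B C \<kappa>
    using A(1) B(1) C(1,2) sub(2) \<kappa> inv well_defined by unfold_locales (simp_all add: closure)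
  have x_0: "x 0 \<in> C" and x_Suc: "\<And>n. x (Suc n) = AAR k A B (x n)"
    using x0 by (simp_all add: x)
  interpret M: Metric_space model_space "model_dist k :: real ^ 'n \<Rightarrow> real ^ 'n \<Rightarrow> real"
    by (rule Metric_space_model[OF k])
  have proj_x: "proj k B (x n) \<in> B" for n
    using B.proj_near(1)[OF near_closure] iterate_closure[OF x_0 x_Suc] by blast
  show ?thesis
  proof (intro conjI allI impI)
    fix r :: "nat \<Rightarrow> nat" and l
    assume "strict_mono r \<and> limitin (model_topology k) (x \<circ> r) l sequentially"
    then have r: "strict_mono r" "(x \<circ> r) \<longlonglongrightarrow> l"
      by (simp_all add: top limitin_subtopology)
    note l = subsequence_limit_N_fixed[OF x_0 x_Suc r]
    show "AAR k A B l = l"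
      by (rule T_fixed_if_N_fixed[OF l])
    show "proj k B l \<in> A \<inter> B"
      by (rule proj_in_Int_if_N_fixed[OF l])
  next
    \<comment> \<open>All distances in the model space are at most
      \<open>model_diam k\<close>.\<close>
    show "M.mbounded (range (\<lambda>n. proj k B (x n)))"
      unfolding M.mbounded_alt using proj_x spheres(2) model_dist_le_diam[OF k] by blast
  next
    fix y
    assume "cluster_point k (\<lambda>n. proj k B (x n)) y"
    then obtain r where "strict_mono r" "(\<lambda>n. proj k B (x (r n))) \<longlonglongrightarrow> y"
      using cluster_point_subsequence[OF k] by (fastforce simp: o_def)
    then show "y \<in> A \<inter> B"
      by (rule shadow_subsequence_limit[of x r y, OF x_0 x_Suc])
  qed
qed

end
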